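(* Let $A_1,\ldots,A_d$ be commuting bounded operators on a separable Hilbert space $\mathcal{H}$ that are doubly commuting (i.e. moreover $[A_j,A_k^*]=0$ for every $j\neq k$), and assume there exists $\xi\in\mathbb{R}^d$ such that $\sum_{j=1}^d\xi_j(A_j-A_j^* )$ is invertible when restricted to the non-Hermitian subspace $\mathcal{E}=\overline{\sum_{j=1}^d\operatorname{Im}(A_j-A_j^* )}$. Then the strict vessel into which $A_1,\ldots,A_d$ embed satisfies the $VR$ conditions.
   Context: $\operatorname{Im}$ denotes the range. The strict vessel into which a commuting tuple $A_1,\ldots,A_d$ embeds consists of: $\mathcal{E}=\overline{\sum_{j}\operatorname{Im}(A_j-A_j^* )}\subset\mathcal{H}$ (the non-Hermitian subspace), $\Phi=P_{\mathcal{E}}:\mathcal{H}\to\mathcal{E}$ the orthogonal projection, and the selfadjoint operators on $\mathcal{E}$: $\sigma_j=\frac1i(A_j-A_j^* )|_{\mathcal{E}}$, $\gamma_{jk}=\frac1i(A_jA_k^*-A_kA_j^* )|_{\mathcal{E}}$, $\gamma_{*jk}=\frac1i(A_k^*A_j-A_j^*A_k)|_{\mathcal{E}}$. VR conditions. For $T=(T_{ij})\in \mathrm{GL}_d(\mathbb{R})$ put $\sigma_j^T=\sum_i T_{ij}\sigma_i$ and $\gamma_{jk}^T=\sum_{i,l}T_{ij}T_{lk}\gamma_{il}$. A vessel satisfies the VR conditions if for some $T\in \mathrm{GL}_d(\mathbb{R})$ the operator $\sigma_1^T$ is invertible and, writing $s_j=\sigma_j^T$, $g_{jk}=\gamma_{jk}^T$,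 for all $j,k=2,\ldots,d$: $[s_1^{-1}s_j,s_1^{-1}s_k]=0$; $[s_1^{-1}g_{1j},s_1^{-1}g_{1k}]=0$; $[s_1^{-1}s_k,s_1^{-1}g_{1j}]=[s_1^{-1}s_j,s_1^{-1}g_{1k}]$; $g_{jk}=s_js_1^{-1}g_{1k}-s_ks_1^{-1}g_{1j}$. (These are the VR conditions in the direction $Te_1$.) *)

theory Defs
  imports
    "HOL-Analysis.Inner_Product"
    "HOL-Analysis.Elementary_Normed_Spaces"
    "HOL-Library.FuncSet"
    "Jordan_Normal_Form.Matrix"
begin

text \<open>
  Complex Hilbert spaces, built on top of the real ones: the norm, the topology and completeness
  come from the underlying real inner product, which is the real part of the complex inner
  product. The complex inner product is linear in the first argument.
\<close>

class complex_hilbert_space = real_inner + complete_space +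
  fixes scaleC :: "complex \<Rightarrow> 'a \<Rightarrow> 'a" (infixr "*\<^sub>C" 75)
    and cinner :: "'a \<Rightarrow> 'a \<Rightarrow> complex"
  assumes scaleC_add_right: "a *\<^sub>C (x + y) = a *\<^sub>C x + a *\<^sub>C y"
    and scaleC_add_left: "(a + b) *\<^sub>C x = a *\<^sub>C x + b *\<^sub>C x"
    and scaleC_scaleC: "a *\<^sub>C b *\<^sub>C x = (a * b) *\<^sub>C x"
    and scaleR_scaleC: "scaleR r x = complex_of_real r *\<^sub>C x"
    and cinner_commute: "cinner x y = cnj (cinner y x)"
    and cinner_add_left: "cinner (x + y) z = cinner x z + cinner y z"
    and cinner_scaleC_left: "cinner (a *\<^sub>C x) y = a * cinner x y"
    and Re_cinner: "Re (cinner x y) = inner x y"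

instantiation complex :: complex_hilbert_space
begin

definition "scaleC_complex = ((*) :: complex \<Rightarrow> complex \<Rightarrow> complex)"
definition "cinner_complex x y = x * cnj (y :: complex)"

instance
  by standard
    (simp_all add: scaleC_complex_def cinner_complex_def inner_complex_def scaleR_conv_of_real
      algebra_simps)

end

definition bounded_clinear :: "('a::complex_hilbert_space \<Rightarrow> 'b::complex_hilbert_space) \<Rightarrow> bool" where
  "bounded_clinear A \<longleftrightarrow> bounded_linear A \<and> (\<forall>c x. A (c *\<^sub>C x) = c *\<^sub>C A x)"

text \<open>For a bounded operator the adjoint exists and is unique by the Riesz representation theorem.\<close>

definition cadjoint :: "('a::complex_hilbert_space \<Rightarrow> 'a) \<Rightarrow> 'a \<Rightarrow> 'a" where
  "cadjoint A = (THE B. \<forall>x y. cinner (A x) y = cinner x (B y))"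

text \<open>Used for closed complex subspaces only, where the projection exists and is unique.\<close>

definition orth_proj :: "'a::complex_hilbert_space set \<Rightarrow> 'a \<Rightarrow> 'a" where
  "orth_proj E x = (THE y. y \<in> E \<and> (\<forall>z\<in>E. cinner (x - y) z = 0))"

text \<open>
  Operators on a closed subspace \<open>E\<close> are functions whose values outside \<open>E\<close> are irrelevant.
  If \<open>S\<close> is invertible on \<open>E\<close>, its inverse there is \<open>inv_into E S\<close>.
\<close>

definition bounded_clinear_on :: "'a::complex_hilbert_space set \<Rightarrow> ('a \<Rightarrow> 'a) \<Rightarrow> bool" where
  "bounded_clinear_on E S \<longleftrightarrow>
     (\<forall>x\<in>E. S x \<in> E) \<and>
     (\<forall>x\<in>E. \<forall>y\<in>E. S (x + y) = S x + S y) \<and>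
     (\<forall>c. \<forall>x\<in>E. S (c *\<^sub>C x) = c *\<^sub>C S x) \<and>
     (\<exists>K. \<forall>x\<in>E. norm (S x) \<le> K * norm x)"

definition invertible_on :: "'a::complex_hilbert_space set \<Rightarrow> ('a \<Rightarrow> 'a) \<Rightarrow> bool" where
  "invertible_on E S \<longleftrightarrow>
     bounded_clinear_on E S \<and>
     (\<exists>R. bounded_clinear_on E R \<and> (\<forall>x\<in>E. R (S x) = x \<and> S (R x) = x))"

definition commutator :: "('a::ab_group_add \<Rightarrow> 'a) \<Rightarrow> ('a \<Rightarrow> 'a) \<Rightarrow> 'a \<Rightarrow> 'a" where
  "commutator X Y x = X (Y x) - Y (X x)"

text \<open>
  Tuples of length \<open>d\<close> are indexed by \<open>0, \<dots>, d - 1\<close>, so that the index \<open>1\<close> of the usual numbering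
  becomes \<open>0\<close> and \<open>2, \<dots>, d\<close> becomes \<open>{1..<d}\<close>; entries beyond \<open>d - 1\<close> are ignored.
\<close>

definition nonhermitian_subspace :: "nat \<Rightarrow> (nat \<Rightarrow> 'a::complex_hilbert_space \<Rightarrow> 'a) \<Rightarrow> 'a set" where
  "nonhermitian_subspace d A =
     closure {\<Sum>j<d. y j | y. \<forall>j<d. y j \<in> range (\<lambda>x. A j x - cadjoint (A j) x)}"

text \<open>
  The data of a vessel; the coefficient space is a closed subspace of some Hilbert space, and
  \<open>gamma_in\<close>, \<open>gamma_out\<close> are the families usually written \<open>\<gamma>\<close> and \<open>\<gamma>\<^sub>*\<close>.
\<close>

record ('h, 'e) vessel =
  operators :: "nat \<Rightarrow> 'h \<Rightarrow> 'h"
  coeff_space :: "'e set"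
  window :: "'h \<Rightarrow> 'e"
  sigma :: "nat \<Rightarrow> 'e \<Rightarrow> 'e"
  gamma_in :: "nat \<Rightarrow> nat \<Rightarrow> 'e \<Rightarrow> 'e"
  gamma_out :: "nat \<Rightarrow> nat \<Rightarrow> 'e \<Rightarrow> 'e"

definition strict_vessel ::
  "nat \<Rightarrow> (nat \<Rightarrow> 'h::complex_hilbert_space \<Rightarrow> 'h) \<Rightarrow> ('h, 'h) vessel" where
  "strict_vessel d A =
     (let E = nonhermitian_subspace d A in
      \<lparr> operators = A,
        coeff_space = E,
        window = orth_proj E,
        sigma = (\<lambda>j. restrict (\<lambda>x. (1 / \<i>) *\<^sub>C (A j x - cadjoint (A j) x)) E),
        gamma_in = (\<lambda>j k. restrict
          (\<lambda>x. (1 / \<i>) *\<^sub>C (A j (cadjoint (A k) x) - A k (cadjoint (A j) x))) E),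
        gamma_out = (\<lambda>j k. restrict
          (\<lambda>x. (1 / \<i>) *\<^sub>C (cadjoint (A k) (A j x) - cadjoint (A j) (A k x))) E) \<rparr>)"

definition sigma_transf ::
  "nat \<Rightarrow> real mat \<Rightarrow> ('h, 'e::complex_hilbert_space) vessel \<Rightarrow> nat \<Rightarrow> 'e \<Rightarrow> 'e" where
  "sigma_transf d T V j x = (\<Sum>i<d. (T $$ (i, j)) *\<^sub>R sigma V i x)"

definition gamma_transf ::
  "nat \<Rightarrow> real mat \<Rightarrow> ('h, 'e::complex_hilbert_space) vessel \<Rightarrow> nat \<Rightarrow> nat \<Rightarrow> 'e \<Rightarrow> 'e" where
  "gamma_transf d T V j k x =
     (\<Sum>i<d. \<Sum>l<d. (T $$ (i, j) * T $$ (l, k)) *\<^sub>R gamma_in V i l x)"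

definition VR_conditions :: "nat \<Rightarrow> ('h, 'e::complex_hilbert_space) vessel \<Rightarrow> bool" where
  "VR_conditions d V \<longleftrightarrow>
     (\<exists>T \<in> carrier_mat d d. invertible_mat T \<and>
       (let E = coeff_space V;
            s = sigma_transf d T V;
            g = gamma_transf d T V;
            r = inv_into E (s 0)
        in invertible_on E (s 0) \<and>
           (\<forall>j\<in>{1..<d}. \<forall>k\<in>{1..<d}. \<forall>x\<in>E.
              commutator (r \<circ> s j) (r \<circ> s k) x = 0 \<and>
              commutator (r \<circ> g 0 j) (r \<circ> g 0 k) x = 0 \<and>
              commutator (r \<circ> s k) (r \<circ> g 0 j) x = commutator (r \<circ> s j) (r \<circ> g 0 k) x \<and>
              g j k x = s j (r (g 0 k x)) - s k (r (g 0 j x)))))"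

end

theory Submission
  imports Defs "Jordan_Normal_Form.Determinant"
begin

text \<open>
  For \<open>u \<in> \<real>\<^sup>d\<close> put \<open>s u = \<Sum>j. u j \<sigma> j\<close> and \<open>a u = \<Sum>j. u j A j\<close>. Double commutativity gives
  \<open>\<gamma> j k = \<sigma> j A k - \<sigma> k A j\<close>, so that \<open>\<gamma>\<close> in the directions \<open>u, v\<close> is \<open>g u v = s u a v - s v a u\<close>.
  The maps \<open>s u\<close> commute with each other, so do the maps \<open>a u\<close>, and \<open>[s u, a v]\<close> is symmetric in
  \<open>u, v\<close>; consequently the total antisymmetrisation of \<open>a u s v a w\<close> vanishes. With \<open>r\<close> the inverse
  of \<open>s u\<close> on \<open>E\<close>, one has \<open>s v r s u = s v\<close> on the whole space, and the VR identities in the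
  direction \<open>u\<close> expand into these symmetries, although the \<open>A j\<close> need not preserve \<open>E\<close>.
\<close>

section \<open>Adjoints\<close>

text \<open>If \<open>f x = inner x z\<close>, then \<open>J x\<close> is the squared distance from
  \<open>x\<close> to \<open>z\<close> minus a constant. So \<open>z\<close> is sought as the
  minimiser of \<open>J\<close>; the parallelogram law makes minimising sequences Cauchy.\<close>

lemma riesz_representation:
  fixes f :: "'a::{real_inner,complete_space} \<Rightarrow> real"
  assumes "bounded_linear f"
  shows "\<exists>z. \<forall>x. f x = inner x z"
proof -
  interpret f: bounded_linear f by fact
  define J where "J x = inner x x - 2 * f x" for x
  obtain K where K: "\<And>x. norm (f x) \<le> norm x * K" using f.bounded by blast
  have J_lower: "- (K\<^sup>2) \<le> J x" for x
  proof -
    have "f x \<le> norm x * K" using K[of x] by simp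
    moreover have "0 \<le> (norm x - K)\<^sup>2" by simp
    ultimately show ?thesis
      by (simp add: J_def power2_norm_eq_inner[symmetric] power2_diff)
  qed
  define m where "m = Inf (range J)"
  have bdd: "bdd_below (range J)" using J_lower by (intro bdd_belowI[of _ "- (K\<^sup>2)"]) auto
  have m_le: "m \<le> J x" for x unfolding m_def by (rule cInf_lower[OF _ bdd]) simp
  have "\<exists>x. J x < m + inverse (real (Suc n))" for n
  proof -
    have "Inf (range J) < m + inverse (real (Suc n))" unfolding m_def by simp
    then show ?thesis using cInf_less_iff[OF _ bdd] by auto
  qed
  then obtain X where X: "\<And>n. J (X n) < m + inverse (real (Suc n))" by metis
  have parallelogram: "(norm (x - y))\<^sup>2 \<le> 2 * (J x + J y - 2 * m)" for x y
  proof -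
    have "J x + J y - 2 * J ((1/2) *\<^sub>R (x + y)) = (norm (x - y))\<^sup>2 / 2"
      unfolding J_def power2_norm_eq_inner
      by (simp add: f.scaleR f.add inner_add_left inner_add_right inner_diff_left inner_diff_right
          inner_commute field_simps)
    with m_le[of "(1/2) *\<^sub>R (x + y)"] show ?thesis by simp
  qed
  have "Cauchy X"
  proof (rule metric_CauchyI)
    fix e :: real assume "0 < e"
    then obtain M where M: "inverse (real (Suc M)) < e\<^sup>2 / 4"
      using reals_Archimedean[of "e\<^sup>2 / 4"] by auto
    have "dist (X k) (X n) < e" if "M \<le> k" "M \<le> n" for k n
    proof -
      have "J (X i) < m + e\<^sup>2 / 4" if "M \<le> i" for i
      proof -
        have "inverse (real (Suc i)) \<le> inverse (real (Suc M))"
          using that by (intro le_imp_inverse_le) auto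
        with X[of i] M show ?thesis by linarith
      qed
      from add_strict_mono[OF this[OF \<open>M \<le> k\<close>] this[OF \<open>M \<le> n\<close>]]
      have "2 * (J (X k) + J (X n) - 2 * m) < e\<^sup>2" by (simp add: field_simps)
      with parallelogram[of "X k" "X n"] have "(norm (X k - X n))\<^sup>2 < e\<^sup>2" by (rule le_less_trans)
      then show ?thesis
        using \<open>0 < e\<close> by (auto simp: dist_norm intro: power_less_imp_less_base)
    qed
    then show "\<exists>M. \<forall>k\<ge>M. \<forall>n\<ge>M. dist (X k) (X n) < e" by blast
  qed
  then obtain z where z: "X \<longlonglongrightarrow> z" using Cauchy_convergent convergent_def by blast
  have "(\<lambda>n. J (X n)) \<longlonglongrightarrow> J z"
    unfolding J_def by (intro tendsto_intros f.tendsto z)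
  moreover have "(\<lambda>n. m + inverse (real (Suc n))) \<longlonglongrightarrow> m + 0"
    by (intro tendsto_intros LIMSEQ_inverse_real_of_nat)
  ultimately have J_min: "J z \<le> m"
    using X by (intro LIMSEQ_le[where Y = "\<lambda>n. m + inverse (real (Suc n))"]) (auto intro: less_imp_le)
  have "f x = inner x z" for x
  proof (rule ccontr)
    assume "f x \<noteq> inner x z"
    define c where "c = inner x z - f x"
    have c: "c \<noteq> 0" using \<open>f x \<noteq> inner x z\<close> by (simp add: c_def)
    then have "x \<noteq> 0" by (auto simp: c_def f.zero)
    then have pos: "0 < inner x x" by simp
    \<comment> \<open>This \<open>t\<close> minimises the quadratic \<open>J\<close> along the line
      through \<open>z\<close> in direction \<open>x\<close>.\<close>
    define t where "t = - (c / inner x x)"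
    have "J (z + t *\<^sub>R x) = J z + (2 * t * c + t * t * inner x x)"
      by (simp add: J_def c_def f.add f.scaleR inner_add_left inner_add_right inner_commute
          algebra_simps)
    also have "2 * t * c + t * t * inner x x = - (c * c / inner x x)"
      using pos by (simp add: t_def field_simps)
    also have "J z + - (c * c / inner x x) < J z"
      using c divide_pos_pos[of "c * c", OF _ pos] not_real_square_gt_zero[of c] by linarith
    finally show False using m_le[of "z + t *\<^sub>R x"] J_min by linarith
  qed
  then show ?thesis by blast
qed

section \<open>Complex inner product and complex scalars\<close>

lemma cinner_scaleC_right: "cinner x (a *\<^sub>C y) = cnj a * cinner x y"
  by (metis cinner_commute cinner_scaleC_left complex_cnj_mult)

lemma cinner_add_right: "cinner x (y + z) = cinner x y + cinner x z"
  by (metis cinner_add_left cinner_commute complex_cnj_add)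

lemma Im_cinner: "Im (cinner x y) = - Re (cinner (\<i> *\<^sub>C x) y)"
  by (simp add: cinner_scaleC_left)

lemma cinner_right_eqI:
  fixes y z :: "'a::complex_hilbert_space"
  assumes "\<And>x. cinner x y = cinner x z"
  shows "y = z"
proof -
  have "inner x y = inner x z" for x using assms[of x] by (metis Re_cinner)
  then have "inner (y - z) (y - z) = 0" by (simp add: inner_diff_right)
  then show ?thesis by simp
qed

lemma norm_scaleC: "norm (c *\<^sub>C (x :: 'a::complex_hilbert_space)) = cmod c * norm x"
proof -
  have "cinner (c *\<^sub>C x) (c *\<^sub>C x) = complex_of_real ((cmod c)\<^sup>2) * cinner x x"
    by (simp only: cinner_scaleC_left cinner_scaleC_right complex_norm_square mult_ac)
  then have "inner (c *\<^sub>C x) (c *\<^sub>C x) = (cmod c)\<^sup>2 * inner x x"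
    by (simp add: Re_cinner[symmetric])
  then show ?thesis by (simp add: norm_eq_sqrt_inner real_sqrt_mult)
qed

lemma scaleC_zero_right [simp]: "c *\<^sub>C (0 :: 'a::complex_hilbert_space) = 0"
  using scaleC_add_right[of c 0 "0 :: 'a"] by simp

lemma scaleC_diff_right: "c *\<^sub>C (x - y) = c *\<^sub>C x - c *\<^sub>C (y :: 'a::complex_hilbert_space)"
  using scaleC_add_right[of c "x - y" y] by (simp add: algebra_simps)

lemma scaleC_one [simp]: "1 *\<^sub>C x = (x :: 'a::complex_hilbert_space)"
  using scaleR_scaleC[of 1 x] by simp

lemma scaleC_scaleR: "c *\<^sub>C r *\<^sub>R x = r *\<^sub>R c *\<^sub>C (x :: 'a::complex_hilbert_space)"
  by (simp add: scaleR_scaleC scaleC_scaleC mult.commute)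

lemma bounded_linear_scaleC: "bounded_linear (\<lambda>x :: 'a::complex_hilbert_space. c *\<^sub>C x)"
  by (rule bounded_linear_intro[where K = "cmod c"])
    (simp_all add: scaleC_add_right scaleC_scaleR norm_scaleC mult.commute)

lemmas scaleC_sum_right = linear_sum[OF bounded_linear.linear[OF bounded_linear_scaleC]]

text \<open>Riesz represents the real part; complex linearity of \<open>A\<close> settles the
  imaginary part, which is minus the real part at \<open>\<i> *\<^sub>C x\<close>. Uniqueness makes
  the description in \<open>cadjoint\<close> meaningful.\<close>

lemma cinner_cadjoint:
  assumes "bounded_clinear A"
  shows "cinner (A x) y = cinner x (cadjoint A y)"
proof -
  have lin: "bounded_linear A" and C: "\<And>c x. A (c *\<^sub>C x) = c *\<^sub>C A x"
    using assms by (auto simp: bounded_clinear_def)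
  have "\<exists>z. \<forall>x. cinner (A x) y = cinner x z" for y
  proof -
    have "bounded_linear (\<lambda>x. inner (A x) y)"
      by (rule bounded_linear_compose[OF bounded_linear_inner_left lin])
    then obtain z where z: "\<And>x. inner (A x) y = inner x z" using riesz_representation by blast
    have "cinner (A x) y = cinner x z" for x
      by (rule complex_eqI) (simp_all add: Re_cinner z Im_cinner flip: C)
    then show ?thesis by blast
  qed
  then obtain B where B: "\<And>x y. cinner (A x) y = cinner x (B y)" by metis
  have "cadjoint A = B"
    unfolding cadjoint_def
  proof (rule the_equality)
    fix B' assume B': "\<forall>x y. cinner (A x) y = cinner x (B' y)"
    show "B' = B"
    proof
      show "B' y = B y" for y by (rule cinner_right_eqI) (use B B' in metis)
    qed
  qed (simp add: B)
  then show ?thesis by (simp add: B)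
qed

lemma cadjoint_add: "bounded_clinear A \<Longrightarrow> cadjoint A (x + y) = cadjoint A x + cadjoint A y"
  by (rule cinner_right_eqI) (simp add: cinner_add_right flip: cinner_cadjoint)

lemma cadjoint_scaleC: "bounded_clinear A \<Longrightarrow> cadjoint A (c *\<^sub>C x) = c *\<^sub>C cadjoint A x"
  by (rule cinner_right_eqI) (simp add: cinner_scaleC_right flip: cinner_cadjoint)

lemma linear_cadjoint: "bounded_clinear A \<Longrightarrow> linear (cadjoint A)"
  by (intro linearI) (simp_all add: cadjoint_add cadjoint_scaleC scaleR_scaleC)

lemma cadjoint_commute:
  assumes "bounded_clinear A" "bounded_clinear B" and "\<And>x. A (B x) = B (A x)"
  shows "cadjoint A (cadjoint B x) = cadjoint B (cadjoint A x)"
  by (rule cinner_right_eqI) (simp add: assms flip: cinner_cadjoint)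

section \<open>Subspaces and real linear combinations of operators\<close>

lemma subspace_closure:
  fixes S :: "'a::real_normed_vector set"
  assumes "subspace S"
  shows "subspace (closure S)"
proof (rule subspaceI)
  show "0 \<in> closure S" using subspace_0[OF assms] closure_subset by blast
next
  fix x y assume "x \<in> closure S" "y \<in> closure S"
  then obtain X Y where X: "\<And>n. X n \<in> S" "X \<longlonglongrightarrow> x" and Y: "\<And>n. Y n \<in> S" "Y \<longlonglongrightarrow> y"
    unfolding closure_sequential by blast
  show "x + y \<in> closure S"
    unfolding closure_sequential
    by (intro exI[of _ "\<lambda>n. X n + Y n"] conjI allI subspace_add[OF assms] tendsto_add X Y)
next
  fix c x assume "x \<in> closure S"
  then obtain X where X: "\<And>n. X n \<in> S" "X \<longlonglongrightarrow> x"
    unfolding closure_sequential by blast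
  show "c *\<^sub>R x \<in> closure S"
    unfolding closure_sequential
    by (intro exI[of _ "\<lambda>n. c *\<^sub>R X n"] conjI allI subspace_scale[OF assms] tendsto_intros X)
qed

text \<open>Real coefficient vectors are functions on \<open>nat\<close> read only below
  \<open>d\<close>; one definition serves both for \<open>A\<close> and for
  \<open>\<sigma>\<close>.\<close>

definition lincomb ::
  "nat \<Rightarrow> (nat \<Rightarrow> 'a::real_vector \<Rightarrow> 'a) \<Rightarrow> (nat \<Rightarrow> real) \<Rightarrow> 'a \<Rightarrow> 'a" where
  "lincomb d F u x = (\<Sum>i<d. u i *\<^sub>R F i x)"

lemma linear_lincomb:
  assumes "\<And>i. i < d \<Longrightarrow> linear (F i)"
  shows "linear (lincomb d F u)"
  unfolding lincomb_def
  using assms by (intro linear_compose_sum ballI linear_compose_scale_right) auto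

lemma lincomb_lincomb:
  assumes "\<And>i. i < d \<Longrightarrow> linear (F i)"
  shows "lincomb d F u (lincomb d G v x) = (\<Sum>i<d. \<Sum>l<d. (u i * v l) *\<^sub>R F i (G l x))"
  unfolding lincomb_def
  using assms by (intro sum.cong refl) (simp add: linear_sum linear_scale scaleR_sum_right)

lemma lincomb_commute:
  assumes "\<And>i. i < d \<Longrightarrow> linear (F i)" "\<And>i. i < d \<Longrightarrow> linear (G i)"
    and "\<And>i l. i < d \<Longrightarrow> l < d \<Longrightarrow> F i (G l x) = G l (F i x)"
  shows "lincomb d F u (lincomb d G v x) = lincomb d G v (lincomb d F u x)"
proof -
  have "lincomb d F u (lincomb d G v x) = (\<Sum>i<d. \<Sum>l<d. (u i * v l) *\<^sub>R F i (G l x))"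
    by (rule lincomb_lincomb[OF assms(1)])
  also have "\<dots> = (\<Sum>l<d. \<Sum>i<d. (v l * u i) *\<^sub>R G l (F i x))"
    by (subst sum.swap) (simp add: assms(3) mult.commute)
  also have "\<dots> = lincomb d G v (lincomb d F u x)"
    by (rule lincomb_lincomb[OF assms(2), symmetric])
  finally show ?thesis .
qed

section \<open>Doubly commuting tuples\<close>

locale doubly_commuting_tuple =
  fixes A :: "nat \<Rightarrow> 'h::complex_hilbert_space \<Rightarrow> 'h" and d :: nat
  assumes bounded: "\<And>j. j < d \<Longrightarrow> bounded_clinear (A j)"
    and commuting: "\<And>j k. j < d \<Longrightarrow> k < d \<Longrightarrow> A j \<circ> A k = A k \<circ> A j"
    and doubly_commuting:
      "\<And>j k. j < d \<Longrightarrow> k < d \<Longrightarrow> j \<noteq> k \<Longrightarrow> A j \<circ> cadjoint (A k) = cadjoint (A k) \<circ> A j"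
begin

abbreviation E :: "'h set" where "E \<equiv> nonhermitian_subspace d A"

text \<open>Defined on the whole space, unlike the restricted \<open>sigma\<close> of the vessel,
  because it is applied to vectors such as \<open>A k x\<close> that may lie outside
  \<open>E\<close>.\<close>

definition \<sigma> :: "nat \<Rightarrow> 'h \<Rightarrow> 'h" where
  "\<sigma> j x = (1 / \<i>) *\<^sub>C (A j x - cadjoint (A j) x)"

abbreviation a :: "(nat \<Rightarrow> real) \<Rightarrow> 'h \<Rightarrow> 'h" where "a \<equiv> lincomb d A"

abbreviation s :: "(nat \<Rightarrow> real) \<Rightarrow> 'h \<Rightarrow> 'h" where "s \<equiv> lincomb d \<sigma>"

definition g :: "(nat \<Rightarrow> real) \<Rightarrow> (nat \<Rightarrow> real) \<Rightarrow> 'h \<Rightarrow> 'h" where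
  "g u v x = s u (a v x) - s v (a u x)"

section \<open>Commutation relations of the single operators\<close>

lemma A_commute: "j < d \<Longrightarrow> k < d \<Longrightarrow> A j (A k x) = A k (A j x)"
  using commuting[of j k] by (metis comp_apply)

lemma A_cadjoint_commute:
  "j < d \<Longrightarrow> k < d \<Longrightarrow> j \<noteq> k \<Longrightarrow> A j (cadjoint (A k) x) = cadjoint (A k) (A j x)"
  using doubly_commuting[of j k] by (metis comp_apply)

lemma cadjoint_A_commute:
  "j < d \<Longrightarrow> k < d \<Longrightarrow> cadjoint (A j) (cadjoint (A k) x) = cadjoint (A k) (cadjoint (A j) x)"
  by (intro cadjoint_commute bounded A_commute)

lemma linear_A: "j < d \<Longrightarrow> linear (A j)"
  using bounded[of j] by (auto simp: bounded_clinear_def bounded_linear.linear)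

lemma A_scaleC: "j < d \<Longrightarrow> A j (c *\<^sub>C x) = c *\<^sub>C A j x"
  using bounded[of j] by (auto simp: bounded_clinear_def)

lemmas operator_simps =
  linear_diff[OF linear_A] linear_diff[OF linear_cadjoint[OF bounded]]
  A_scaleC cadjoint_scaleC[OF bounded] scaleC_diff_right

lemma \<sigma>_scaleC: "j < d \<Longrightarrow> \<sigma> j (c *\<^sub>C x) = c *\<^sub>C \<sigma> j x"
  by (simp add: \<sigma>_def operator_simps scaleC_scaleC mult.commute)

lemma linear_\<sigma>: "j < d \<Longrightarrow> linear (\<sigma> j)"
  by (intro linearI)
    (simp_all add: \<sigma>_scaleC scaleR_scaleC,
      simp add: \<sigma>_def linear_add[OF linear_A] cadjoint_add[OF bounded] add_diff_add
        scaleC_add_right)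

text \<open>For distinct indices, \<open>A j\<close> and its adjoint commute with \<open>A k\<close>
  and its adjoint. Equal indices are trivial, although \<open>A j\<close> may fail to be
  normal.\<close>

lemma \<sigma>_commute:
  assumes "j < d" "k < d"
  shows "\<sigma> j (\<sigma> k x) = \<sigma> k (\<sigma> j x)"
proof (cases "j = k")
  case False
  with assms show ?thesis
    by (simp add: \<sigma>_def operator_simps A_commute[of k j] cadjoint_A_commute[of k j]
        A_cadjoint_commute)
qed simp

lemma \<sigma>_A_commute: "j < d \<Longrightarrow> k < d \<Longrightarrow> j \<noteq> k \<Longrightarrow> \<sigma> j (A k x) = A k (\<sigma> j x)"
  by (simp add: \<sigma>_def operator_simps A_commute[of k j] A_cadjoint_commute)

text \<open>On the right the products of \<open>A j\<close> and \<open>A k\<close> cancel, and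
  double commutativity moves the adjoints inside. For \<open>j = k\<close> both sides
  vanish.\<close>

lemma \<gamma>_eq:
  assumes "j < d" "k < d"
  shows "(1 / \<i>) *\<^sub>C (A j (cadjoint (A k) x) - A k (cadjoint (A j) x)) = \<sigma> j (A k x) - \<sigma> k (A j x)"
proof (cases "j = k")
  case False
  with assms show ?thesis
    by (simp add: \<sigma>_def operator_simps A_commute[of k j] A_cadjoint_commute)
qed simp

section \<open>Symmetries of the linear combinations\<close>

lemmas linear_a = linear_lincomb[where F = A, OF linear_A]
lemmas linear_s = linear_lincomb[where F = \<sigma>, OF linear_\<sigma>]

text \<open>Identifies \<open>g u v\<close> with the transformed \<open>gamma_in\<close> of the
  vessel. Exchanging the indices in the second half of \<open>g\<close> pairs the terms as in
  \<open>\<gamma>_eq\<close>.\<close>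

lemma g_eq_sum:
  "g u v x = (\<Sum>i<d. \<Sum>l<d. (u i * v l) *\<^sub>R
     ((1 / \<i>) *\<^sub>C (A i (cadjoint (A l) x) - A l (cadjoint (A i) x))))"
proof -
  have "g u v x = (\<Sum>i<d. \<Sum>l<d. (u i * v l) *\<^sub>R \<sigma> i (A l x)) -
      (\<Sum>i<d. \<Sum>l<d. (v i * u l) *\<^sub>R \<sigma> i (A l x))"
    by (simp only: g_def lincomb_lincomb linear_\<sigma>)
  also have "(\<Sum>i<d. \<Sum>l<d. (v i * u l) *\<^sub>R \<sigma> i (A l x)) =
      (\<Sum>i<d. \<Sum>l<d. (u i * v l) *\<^sub>R \<sigma> l (A i x))"
    by (subst sum.swap) (simp add: mult.commute)
  finally show ?thesis
    by (simp only: sum_subtractf[symmetric] scaleR_diff_right[symmetric])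
      (intro sum.cong refl, simp only: \<gamma>_eq lessThan_iff)
qed

lemma s_commute: "s u (s v x) = s v (s u x)"
  by (intro lincomb_commute linear_\<sigma> \<sigma>_commute)

lemma a_commute: "a u (a v x) = a v (a u x)"
  by (intro lincomb_commute linear_A A_commute)

text \<open>Only the diagonal terms \<open>[\<sigma> i, A i]\<close> survive in \<open>[s u, a v]\<close>.\<close>

lemma s_a_commutator_sym: "s u (a v x) - a v (s u x) = s v (a u x) - a u (s v x)"
proof -
  have eq: "s u (a v x) - a v (s u x) =
      (\<Sum>i<d. \<Sum>l<d. (u i * v l) *\<^sub>R (\<sigma> i (A l x) - A l (\<sigma> i x)))" for u v
  proof -
    have "a v (s u x) = (\<Sum>i<d. \<Sum>l<d. (u i * v l) *\<^sub>R A l (\<sigma> i x))"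
      by (subst sum.swap) (simp add: lincomb_lincomb linear_A mult.commute)
    then show ?thesis
      by (simp only: lincomb_lincomb linear_\<sigma> sum_subtractf scaleR_diff_right)
  qed
  have "(u i * v l) *\<^sub>R (\<sigma> i (A l x) - A l (\<sigma> i x)) = (v l * u i) *\<^sub>R (\<sigma> l (A i x) - A i (\<sigma> l x))"
    if "i < d" "l < d" for i l
    using that by (cases "i = l") (simp_all add: \<sigma>_A_commute)
  then show ?thesis
    unfolding eq by (subst (2) sum.swap) (intro sum.cong refl, simp)
qed

text \<open>With the \<open>a\<close> maps on the left, \<open>g u v\<close> can be applied after
  \<open>r\<close>: its factor \<open>s u\<close> then cancels \<open>r\<close>.\<close>

lemma g_eq': "g u v x = a v (s u x) - a u (s v x)"
  using s_a_commutator_sym[of u v x] by (simp add: g_def algebra_simps)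

text \<open>The difference of the sides is, up to sign, the alternating sum of
  \<open>a p (s q (a r x))\<close> over the orderings of \<open>u\<close>, \<open>v\<close>,
  \<open>w\<close>. Moving \<open>s q\<close> to the front leaves one term symmetric in
  \<open>p\<close>, \<open>r\<close> and a commutator term symmetric in \<open>p\<close>,
  \<open>q\<close>; both cancel under alternation.\<close>

lemma antisymmetrised_asa:
  "a v (s u (a w x)) - a v (s w (a u x)) - a u (s v (a w x)) =
   a w (s u (a v x)) - a w (s v (a u x)) - a u (s w (a v x))"
proof -
  define D where "D p q y = s p (a q y) - a q (s p y)" for p q y
  have D: "D p q y = D q p y" for p q y
    unfolding D_def by (rule s_a_commutator_sym)
  have asa: "a p (s q (a r x)) = s q (a p (a r x)) - D q p (a r x)" for p q r
    by (simp add: D_def)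
  show ?thesis
    unfolding asa D[of w u] D[of v u] D[of w v]
    by (simp add: a_commute[of w u] a_commute[of v u] a_commute[of w v])
qed

section \<open>The non-Hermitian subspace\<close>

text \<open>The factor \<open>1 / \<i>\<close> is absorbed into the arguments. This makes
  \<open>E\<close> the closure of the range of a linear map on tuples, so its linear structure can
  be read off.\<close>

lemma nonhermitian_subspace_eq:
  "E = closure (range (\<lambda>y. \<Sum>j<d. \<sigma> j (y j)))"
proof -
  have "{\<Sum>j<d. y j | y. \<forall>j<d. y j \<in> range (\<lambda>x. A j x - cadjoint (A j) x)} =
      range (\<lambda>y. \<Sum>j<d. \<sigma> j (y j))" (is "?L = ?R")
  proof
    show "?L \<subseteq> ?R"
    proof
      fix w assume "w \<in> ?L"
      then obtain y where w: "w = (\<Sum>j<d. y j)"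
        and "\<forall>j<d. y j \<in> range (\<lambda>x. A j x - cadjoint (A j) x)" by blast
      then have "\<forall>j. \<exists>x. j < d \<longrightarrow> y j = A j x - cadjoint (A j) x" by blast
      then obtain x where x: "\<And>j. j < d \<Longrightarrow> y j = A j (x j) - cadjoint (A j) (x j)" by metis
      have "w = (\<Sum>j<d. \<sigma> j (\<i> *\<^sub>C x j))"
        unfolding w by (intro sum.cong refl) (simp add: \<sigma>_scaleC, simp add: \<sigma>_def scaleC_scaleC x)
      then show "w \<in> ?R" by auto
    qed
    show "?R \<subseteq> ?L"
    proof
      fix w assume "w \<in> ?R"
      then obtain y where w: "w = (\<Sum>j<d. \<sigma> j (y j))" by blast
      have "\<sigma> j (y j) \<in> range (\<lambda>x. A j x - cadjoint (A j) x)" if "j < d" for j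
        using that by (intro range_eqI[of _ _ "(1 / \<i>) *\<^sub>C y j"]) (simp add: \<sigma>_def operator_simps)
      with w show "w \<in> ?L" by blast
    qed
  qed
  then show ?thesis by (simp add: nonhermitian_subspace_def)
qed

lemma subspace_E: "subspace E"
proof -
  have "subspace (range (\<lambda>y. \<Sum>j<d. \<sigma> j (y j)))" (is "subspace ?R")
  proof (rule subspaceI)
    show "0 \<in> ?R"
      by (intro range_eqI[of _ _ "\<lambda>_. 0"]) (simp add: linear_0[OF linear_\<sigma>])
  next
    fix w w' assume "w \<in> ?R" "w' \<in> ?R"
    then obtain y y' where "w = (\<Sum>j<d. \<sigma> j (y j))" "w' = (\<Sum>j<d. \<sigma> j (y' j))" by blast
    then show "w + w' \<in> ?R"
      by (intro range_eqI[of _ _ "\<lambda>j. y j + y' j"])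
        (simp add: linear_add[OF linear_\<sigma>] sum.distrib)
  next
    fix c w assume "w \<in> ?R"
    then obtain y where "w = (\<Sum>j<d. \<sigma> j (y j))" by blast
    then show "c *\<^sub>R w \<in> ?R"
      by (intro range_eqI[of _ _ "\<lambda>j. c *\<^sub>R y j"])
        (simp add: linear_scale[OF linear_\<sigma>] scaleR_sum_right)
  qed
  then show ?thesis unfolding nonhermitian_subspace_eq by (rule subspace_closure)
qed

lemma scaleC_E:
  assumes "x \<in> E"
  shows "c *\<^sub>C x \<in> E"
proof -
  let ?R = "range (\<lambda>y. \<Sum>j<d. \<sigma> j (y j))"
  have "c *\<^sub>C w \<in> ?R" if "w \<in> ?R" for w
  proof -
    from that obtain y where "w = (\<Sum>j<d. \<sigma> j (y j))" by blast
    then show ?thesis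
      by (intro range_eqI[of _ _ "\<lambda>j. c *\<^sub>C y j"]) (simp add: \<sigma>_scaleC scaleC_sum_right)
  qed
  then have "(\<lambda>x. c *\<^sub>C x) ` closure ?R \<subseteq> closure ?R"
    by (intro image_closure_subset bounded_linear.continuous_on[OF bounded_linear_scaleC]
        continuous_on_id closed_closure image_subsetI subsetD[OF closure_subset])
  with assms show ?thesis unfolding nonhermitian_subspace_eq by blast
qed

text \<open>The real weights are absorbed into the arguments. As \<open>x\<close> is arbitrary,
  \<open>r\<close> may follow any \<open>s u\<close>, even at vectors outside
  \<open>E\<close>.\<close>

lemma s_in_E: "s u x \<in> E"
proof -
  have "s u x = (\<Sum>j<d. \<sigma> j (u j *\<^sub>R x))"
    unfolding lincomb_def by (intro sum.cong refl) (simp add: linear_scale[OF linear_\<sigma>])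
  then show ?thesis unfolding nonhermitian_subspace_eq by (auto intro: subsetD[OF closure_subset])
qed

lemma g_in_E: "g u v x \<in> E"
  unfolding g_def by (intro subspace_diff[OF subspace_E] s_in_E)

section \<open>The VR identities\<close>

context
  fixes u :: "nat \<Rightarrow> real" and r :: "'h \<Rightarrow> 'h"
  assumes r_in_E: "x \<in> E \<Longrightarrow> r x \<in> E"
    and s_r: "x \<in> E \<Longrightarrow> s u (r x) = x"
    and r_s: "x \<in> E \<Longrightarrow> r (s u x) = x"
begin

text \<open>Uniqueness of preimages under \<open>s u\<close> in \<open>E\<close>; additivity of
  \<open>r\<close> and its commutation with every \<open>s v\<close> are derived from it.\<close>

lemma r_eqI: "x \<in> E \<Longrightarrow> y \<in> E \<Longrightarrow> s u y = x \<Longrightarrow> r x = y"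
  using r_s by blast

lemma r_diff: "x \<in> E \<Longrightarrow> y \<in> E \<Longrightarrow> r (x - y) = r x - r y"
  by (intro r_eqI subspace_diff[OF subspace_E] r_in_E) (simp_all add: linear_diff[OF linear_s] s_r)

lemma r_s_commute: "x \<in> E \<Longrightarrow> r (s v x) = s v (r x)"
  by (intro r_eqI s_in_E) (simp add: s_commute[of u] s_r)

text \<open>Here \<open>x\<close> need not lie in \<open>E\<close>: on the orthogonal complement of \<open>E\<close> both sides vanish.\<close>

lemma s_r_s: "s v (r (s u x)) = s v x"
proof -
  have "s v (r (s u x)) = r (s v (s u x))" by (simp add: r_s_commute s_in_E)
  also have "\<dots> = s v x" by (intro r_eqI s_in_E) (rule s_commute)
  finally show ?thesis .
qed

text \<open>Both terms of \<open>g u v\<close> lie in \<open>E\<close>, so \<open>r\<close> splits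
  over them; in the first, \<open>s_r_s\<close> removes \<open>r\<close> together with
  \<open>s u\<close>.\<close>

lemma s_r_g: "s w (r (g u v x)) = s w (a v x) - s w (r (s v (a u x)))"
  by (simp add: g_def r_diff s_in_E linear_diff[OF linear_s] s_r_s)

text \<open>Expanding the outer \<open>g\<close> by \<open>g_eq'\<close> lets \<open>s u\<close>
  cancel \<open>r\<close>; \<open>s_r_g\<close> treats the rest. The last term is symmetric in
  \<open>v\<close> and \<open>w\<close>.\<close>

lemma g_r_g: "g u v (r (g u w x)) =
  a v (s u (a w x)) - a v (s w (a u x)) - a u (s v (a w x)) + a u (s v (r (s w (a u x))))"
proof -
  have "g u v (r (g u w x)) = a v (g u w x) - a u (s v (r (g u w x)))"
    by (simp add: g_eq'[of u v] s_r g_in_E)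
  then show ?thesis unfolding s_r_g by (simp add: g_def linear_diff[OF linear_a])
qed

text \<open>Moving \<open>r\<close> to the front turns either side into
  \<open>r (s v (s w x))\<close>.\<close>

lemma s_r_s_commute: "s v (r (s w x)) = s w (r (s v x))"
  by (metis r_s_commute s_commute s_in_E)

lemma VR1: "x \<in> E \<Longrightarrow> commutator (r \<circ> s v) (r \<circ> s w) x = 0"
  by (simp add: commutator_def s_r_s_commute[of v w])

text \<open>The last terms of the two instances of \<open>g_r_g\<close> cancel; the other six form
  the vanishing alternating sum.\<close>

lemma VR2: "x \<in> E \<Longrightarrow> commutator (r \<circ> g u v) (r \<circ> g u w) x = 0"
  using antisymmetrised_asa[of v u w x]
  by (simp add: commutator_def g_r_g s_r_s_commute[of v w])

text \<open>Once the outer \<open>r\<close> is pulled out, each side is a commutator of an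
  \<open>s\<close> with an \<open>a\<close>, symmetric in \<open>v\<close> and \<open>w\<close>,
  plus two terms matched by \<open>s_r_s_commute\<close>.\<close>

lemma VR3:
  assumes "x \<in> E"
  shows "commutator (r \<circ> s w) (r \<circ> g u v) x = commutator (r \<circ> s v) (r \<circ> g u w) x"
proof -
  have g_r_s: "g u v (r (s w x)) = a v (s w x) - a u (s v (r (s w x)))" for v w
    by (simp add: g_eq' s_r s_in_E)
  have "s w (r (g u v x)) - g u v (r (s w x)) = s v (r (g u w x)) - g u w (r (s v x))"
    unfolding s_r_g g_r_s s_r_s_commute[of w v]
    using s_a_commutator_sym[of w v x] by (simp add: algebra_simps)
  then show ?thesis
    by (simp add: commutator_def s_in_E g_in_E flip: r_diff)
qed

text \<open>In the expansion by \<open>s_r_g\<close> the terms still containing \<open>r\<close>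
  agree and cancel.\<close>

lemma VR4: "g v w x = s v (r (g u w x)) - s w (r (g u v x))"
  unfolding s_r_g s_r_s_commute[of v w] by (simp add: g_def)

end

end

section \<open>The vessel\<close>

text \<open>Column \<open>0\<close> is \<open>\<xi>\<close> and the others are the unit vectors
  except the \<open>p\<close>-th, indexed through the transposition of \<open>0\<close> and
  \<open>p\<close>.\<close>

lemma exists_invertible_mat_first_column:
  fixes \<xi> :: "nat \<Rightarrow> 'a::field"
  assumes "p < d" "\<xi> p \<noteq> 0"
  shows "\<exists>T \<in> carrier_mat d d. invertible_mat T \<and> (\<forall>i<d. T $$ (i, 0) = \<xi> i)"
proof -
  define \<tau> where "\<tau> = Transposition.transpose 0 p"
  define T where "T = mat d d (\<lambda>(i, j). if j = 0 then \<xi> i else of_bool (i = \<tau> j))"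
  \<comment> \<open>Column \<open>k\<close> of \<open>S\<close> gives the coordinates of the
    \<open>k\<close>-th unit vector in the columns of \<open>T\<close>; the \<open>p\<close>-th one
    is obtained by solving column \<open>0\<close> for it.\<close>
  define S where "S = mat d d (\<lambda>(j, k). if j = 0 then of_bool (k = p) / \<xi> p
    else of_bool (k = \<tau> j) - \<xi> (\<tau> j) * of_bool (k = p) / \<xi> p)"
  have \<tau>: "i = \<tau> j \<longleftrightarrow> j = \<tau> i" "\<tau> (\<tau> i) = i" "\<tau> i = 0 \<longleftrightarrow> i = p" "i < d \<Longrightarrow> \<tau> i < d" for i j
    using assms by (auto simp: \<tau>_def Transposition.transpose_def)
  have "T * S = 1\<^sub>m d"
  proof (rule eq_matI)
    fix i k assume "i < dim_row (1\<^sub>m d :: 'a mat)" "k < dim_col (1\<^sub>m d :: 'a mat)"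
    then have ik: "i < d" "k < d" by simp_all
    define e where "e = of_bool (k = i) - \<xi> i * of_bool (k = p) / \<xi> p"
    have "(T * S) $$ (i, k) = (\<Sum>j<d. T $$ (i, j) * S $$ (j, k))"
      using ik by (simp add: T_def S_def scalar_prod_def atLeast0LessThan)
    \<comment> \<open>Row \<open>i\<close> of \<open>T\<close> is supported in columns
      \<open>0\<close> and \<open>\<tau> i\<close>, which coincide exactly when
      \<open>i = p\<close>.\<close>
    also have "\<dots> = (\<Sum>j<d. (if j = 0 then \<xi> i * of_bool (k = p) / \<xi> p else 0)
        + (if j = \<tau> i then (if i = p then 0 else e) else 0))"
      using ik by (intro sum.cong refl) (auto simp: T_def S_def e_def \<tau>)
    also have "\<dots> = \<xi> i * of_bool (k = p) / \<xi> p + (if i = p then 0 else e)"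
      using ik assms \<tau>(4)[of i] by (simp add: sum.distrib)
    also have "\<dots> = 1\<^sub>m d $$ (i, k)"
      using ik assms by (auto simp: e_def)
    finally show "(T * S) $$ (i, k) = 1\<^sub>m d $$ (i, k)" .
  qed (simp_all add: T_def S_def)
  moreover have TS: "T \<in> carrier_mat d d" "S \<in> carrier_mat d d" by (simp_all add: T_def S_def)
  ultimately have "S * T = 1\<^sub>m d" by (metis mat_mult_left_right_inverse)
  with \<open>T * S = 1\<^sub>m d\<close> have "invertible_mat T"
    unfolding invertible_mat_def inverts_mat_def square_mat.simps
    using carrier_matD[OF TS(1)] carrier_matD[OF TS(2)] by metis
  moreover have "T $$ (i, 0) = \<xi> i" if "i < d" for i using that by (simp add: T_def)
  ultimately show ?thesis using TS(1) by blast
qed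

text \<open>On \<open>E\<close>, \<open>s \<xi>\<close> is \<open>1 / \<i>\<close> times the given
  operator, so \<open>\<i>\<close> times the given inverse inverts it. \<open>f\<close> stands for
  maps prescribed only on \<open>E\<close>, such as \<open>sigma_transf\<close>.\<close>

lemma (in doubly_commuting_tuple) invertible_on_s:
  assumes "invertible_on E (\<lambda>x. \<Sum>j<d. \<xi> j *\<^sub>R (A j x - cadjoint (A j) x))"
    and f: "\<And>x. x \<in> E \<Longrightarrow> f x = s \<xi> x"
  shows "invertible_on E f"
proof -
  define B where "B = (\<lambda>x. \<Sum>j<d. \<xi> j *\<^sub>R (A j x - cadjoint (A j) x))"
  obtain R where B: "bounded_clinear_on E B" and R: "bounded_clinear_on E R"
    and inv: "\<And>x. x \<in> E \<Longrightarrow> R (B x) = x \<and> B (R x) = x"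
    using assms(1) unfolding invertible_on_def B_def by blast
  have f_eq: "f x = (1 / \<i>) *\<^sub>C B x" if "x \<in> E" for x
    using that
    by (simp add: f lincomb_def \<sigma>_def B_def scaleC_sum_right scaleC_scaleR)
  have "bounded_clinear_on E f"
    unfolding bounded_clinear_on_def
  proof (intro conjI ballI allI)
    obtain K where "\<forall>x\<in>E. norm (B x) \<le> K * norm x"
      using B by (auto simp: bounded_clinear_on_def)
    then show "\<exists>K. \<forall>x\<in>E. norm (f x) \<le> K * norm x"
      by (intro exI[of _ K]) (simp add: f_eq norm_scaleC norm_divide)
  next
    fix c x assume "x \<in> E"
    then show "f (c *\<^sub>C x) = c *\<^sub>C f x"
      using B by (simp add: f_eq scaleC_E bounded_clinear_on_def scaleC_scaleC mult.commute)
  qed (use B in \<open>simp_all add: f s_in_E subspace_add[OF subspace_E] linear_add[OF linear_s]\<close>)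
  moreover have "bounded_clinear_on E (\<lambda>x. \<i> *\<^sub>C R x)"
    using R by (simp add: bounded_clinear_on_def scaleC_E scaleC_add_right scaleC_scaleC
        mult.commute norm_scaleC)
  moreover have "\<i> *\<^sub>C R (f x) = x \<and> f (\<i> *\<^sub>C R x) = x" if "x \<in> E" for x
    using that B R inv[OF that]
    by (simp add: f_eq scaleC_E bounded_clinear_on_def scaleC_scaleC)
  ultimately show ?thesis unfolding invertible_on_def by blast
qed

text \<open>If the given \<open>\<xi>\<close> vanishes, then \<open>E = {0}\<close> and every vector serves.\<close>

lemma (in doubly_commuting_tuple) invertible_direction_nonzero:
  assumes "1 \<le> d"
    and "invertible_on E (\<lambda>x. \<Sum>j<d. \<xi> j *\<^sub>R (A j x - cadjoint (A j) x))"
  shows "\<exists>\<xi> p. p < d \<and> \<xi> p \<noteq> 0 \<and>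
    invertible_on E (\<lambda>x. \<Sum>j<d. \<xi> j *\<^sub>R (A j x - cadjoint (A j) x))"
proof (cases "\<exists>p<d. \<xi> p \<noteq> 0")
  case False
  then have "invertible_on E (\<lambda>x. 0)" using assms(2) by simp
  then obtain R where "bounded_clinear_on E R" "\<And>x. x \<in> E \<Longrightarrow> (0 :: 'h) = x"
    unfolding invertible_on_def by blast
  then have E: "E = {0}" using subspace_0[OF subspace_E] by blast
  have "invertible_on E (\<lambda>x. \<Sum>j<d. (1::real) *\<^sub>R (A j x - cadjoint (A j) x))"
    unfolding invertible_on_def bounded_clinear_on_def E
    by (auto simp: linear_0[OF linear_A] linear_0[OF linear_cadjoint[OF bounded]]
        intro!: exI[of _ "\<lambda>x. x"] exI[of _ 0])
  then show ?thesis using assms(1) by (intro exI[of _ "\<lambda>_. 1"] exI[of _ 0]) auto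
qed (use assms in blast)

theorem corollary4p8:
  fixes A :: "nat \<Rightarrow> 'h::complex_hilbert_space \<Rightarrow> 'h" and d :: nat
  assumes "1 \<le> d"
    and separable: "\<exists>D :: 'h set. countable D \<and> closure D = UNIV"
    and bounded: "\<And>j. j < d \<Longrightarrow> bounded_clinear (A j)"
    and commuting: "\<And>j k. j < d \<Longrightarrow> k < d \<Longrightarrow> A j \<circ> A k = A k \<circ> A j"
    and doubly_commuting:
      "\<And>j k. j < d \<Longrightarrow> k < d \<Longrightarrow> j \<noteq> k \<Longrightarrow> A j \<circ> cadjoint (A k) = cadjoint (A k) \<circ> A j"
    and invertible: "\<exists>\<xi> :: nat \<Rightarrow> real.
      invertible_on (nonhermitian_subspace d A) (\<lambda>x. \<Sum>j<d. \<xi> j *\<^sub>R (A j x - cadjoint (A j) x))"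
  shows "VR_conditions d (strict_vessel d A)"
proof -
  interpret doubly_commuting_tuple A d by unfold_locales fact+
  obtain \<xi> p where \<xi>: "p < d" "\<xi> p \<noteq> 0"
    and inv: "invertible_on E (\<lambda>x. \<Sum>j<d. \<xi> j *\<^sub>R (A j x - cadjoint (A j) x))"
    using invertible invertible_direction_nonzero[OF \<open>1 \<le> d\<close>] by blast
  obtain T where T: "T \<in> carrier_mat d d" "invertible_mat T" and T0: "\<And>i. i < d \<Longrightarrow> T $$ (i, 0) = \<xi> i"
    using exists_invertible_mat_first_column[of p d \<xi>, OF \<xi>] by blast
  define V where "V = strict_vessel d A"
  define c where "c j = (\<lambda>i. T $$ (i, j))" for j
  define r where "r = inv_into E (sigma_transf d T V 0)"
  have coeff: "coeff_space V = E" by (simp add: V_def strict_vessel_def Let_def)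
  have s: "sigma_transf d T V j x = s (c j) x" if "x \<in> E" for j x
    using that
    by (simp add: V_def strict_vessel_def Let_def sigma_transf_def lincomb_def \<sigma>_def c_def)
  have g: "gamma_transf d T V j k x = g (c j) (c k) x" if "x \<in> E" for j k x
    using that
    by (simp add: V_def strict_vessel_def Let_def gamma_transf_def g_eq_sum c_def)
  \<comment> \<open>The functions \<open>c 0\<close> and \<open>\<xi>\<close> are known to agree
    only below \<open>d\<close>, so the operators are compared instead.\<close>
  have "s (c 0) x = s \<xi> x" for x by (simp add: lincomb_def c_def T0)
  then have s0: "invertible_on E (sigma_transf d T V 0)"
    by (intro invertible_on_s[OF inv]) (simp add: s)
  then obtain R where R: "\<And>x. x \<in> E \<Longrightarrow> R x \<in> E"
    "\<And>x. x \<in> E \<Longrightarrow> R (s (c 0) x) = x" "\<And>x. x \<in> E \<Longrightarrow> s (c 0) (R x) = x"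
    unfolding invertible_on_def bounded_clinear_on_def by (metis s)
  \<comment> \<open>Injectivity on \<open>E\<close> identifies \<open>inv_into\<close> with the
    bounded inverse there.\<close>
  have r: "r x = R x" if "x \<in> E" for x
    unfolding r_def
  proof (rule inv_into_f_eq)
    show "inj_on (sigma_transf d T V 0) E" by (rule inj_on_inverseI[of _ R]) (simp add: s R)
  qed (simp_all add: that s R)
  have r_props: "x \<in> E \<Longrightarrow> r x \<in> E" "x \<in> E \<Longrightarrow> s (c 0) (r x) = x" "x \<in> E \<Longrightarrow> r (s (c 0) x) = x" for x
    by (simp_all add: r R s_in_E)
  note VR = VR1[of r "c 0", OF r_props] VR2[of r "c 0", OF r_props]
    VR3[of r "c 0", OF r_props] VR4[of r "c 0", OF r_props]
  have "commutator (r \<circ> sigma_transf d T V j) (r \<circ> sigma_transf d T V k) x = 0 \<and>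
      commutator (r \<circ> gamma_transf d T V 0 j) (r \<circ> gamma_transf d T V 0 k) x = 0 \<and>
      commutator (r \<circ> sigma_transf d T V k) (r \<circ> gamma_transf d T V 0 j) x =
        commutator (r \<circ> sigma_transf d T V j) (r \<circ> gamma_transf d T V 0 k) x \<and>
      gamma_transf d T V j k x = sigma_transf d T V j (r (gamma_transf d T V 0 k x)) -
        sigma_transf d T V k (r (gamma_transf d T V 0 j x))" if "x \<in> E" for j k x
    \<comment> \<open>For \<open>x\<close> in \<open>E\<close> all intermediate values stay in
      \<open>E\<close>, so the restricted families may be replaced by \<open>s\<close> and
      \<open>g\<close>.\<close>
    using VR(1)[of x "c j" "c k"] VR(2)[of x "c j" "c k"] VR(3)[of x "c k" "c j"]
      VR(4)[of "c j" "c k" x] that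
    by (simp add: commutator_def s g r_props s_in_E g_in_E)
  then show ?thesis
    using T s0 unfolding VR_conditions_def Let_def coeff[unfolded V_def] r_def V_def by blast
qed

end
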